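(* Algorithm AONG (alternating optimization with No-Good constraints, described in the context) terminates after finitely many iterations and returns an optimal solution of the PPOP problem $\min\{\|\beta\|_0:\ \beta\in\{0,1\}^{|V|},\ \psi_a(\beta)=0\}$.
   Context: Grid. $(V,E)$ is a connected undirected graph (buses, lines). Each line $e$ has a reactance $r_e>0$ and an arbitrary orientation. $\tilde D\in\{-1,0,1\}^{|V|\times|E|}$ is the incidence matrix ($1$ if the line comes out of the node, $-1$ if it goes into the node, $0$ otherwise), with rows $\tilde D_u$ and columns $\tilde d_e$. $\Gamma=\mathrm{diag}(1/r_e)$, with diagonal entries $\Gamma_e$, and $\tilde B=\tilde D\Gamma\tilde D^T$. $V_g,V_d\subseteq V$ are the generator and load buses, and $\Lambda_g,\Lambda_d$ are the 0/1 matrices selecting the corresponding coordinates of a vector in $\mathbb R^{|V|}$. $\Lambda_p,\Lambda_f$ are 0/1 matrices selecting the measured buses and the measured lines. $u_0\in V$ is a reference node. Further data: pre-attack injections $p_0\in\mathbb R^{|V|}$, line limits $f_{\max}\in\mathbb R^{|E|}$, tripping thresholds $\gamma_e$ ($e\in E$), generation bounds $p_{g,\min},p_{g,\max}$, cost vector $\phi\in\mathbb R^{|V_g|}$, load fluctuation $\alpha\ge 0$, attack budgets $\xi_p,\xi_c$ (possibly $\infty$). $\|\cdot\|_0$ is the number of nonzero entries; vector inequalities and $|\cdot|$ of vectors are entrywise. SCED. For $p\in\mathbb R^{|V|}$, $\psi_s(p)$ is the set of minimizers of $\phi^T\Lambda_g\tilde B\theta$ over $\theta\in\mathbb R^{|V|}$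 with $\Lambda_d\tilde B\theta=\Lambda_d p$, $-f_{\max}\le\Gamma\tilde D^T\theta\le f_{\max}$, $p_{g,\min}\le\Lambda_g\tilde B\theta\le p_{g,\max}$. PMUs. For $\beta\in\{0,1\}^{|V|}$ ($\beta_u=1$ iff a secured PMU is at $u$): $x_{N,u}=1$ iff $\beta_v=1$ for some $v$ equal or adjacent to $u$, else $x_{N,u}=0$; $x_{L,e}=1$ iff some endpoint $v$ of $e$ has $\beta_v=1$, else $x_{L,e}=0$. Attacker's problem. $\psi_a(\beta)$ is the maximum of $|\{e\in E:\ |f_{3,e}|>\gamma_e f_{\max,e}\}|$ over $a_p\in\{0,1\}^{|E|}$, $\theta_2,\theta_3,\tilde\theta_2,\tilde\theta_3\in\mathbb R^{|V|}$, $f_2,f_3,\tilde f_2,f_{con}\in\mathbb R^{|E|}$ subject to: (1) $\tilde D_{u_0}f_{con}=|V|-1$, $\tilde D_u f_{con}=-1$ for $u\ne u_0$, and $|f_{con,e}|\le|V|(1-a_{p,e})$ for all $e$; (2) $x_{L,e}=1\Rightarrow a_{p,e}=0$; $x_{N,u}=1\Rightarrow\tilde\theta_{2,u}=\theta_{2,u}$; $\|a_p\|_0\le\xi_p$; (3) $\tilde Df_2=p_0$, and for each $e$: $f_{2,e}=0$ if $a_{p,e}=1$, $f_{2,e}=\Gamma_e\tilde d_e^T\theta_2$ if $a_{p,e}=0$; (4) $\tilde f_2=\Gamma\tilde D^T\tilde\theta_2$, $-f_{\max}\le\tilde f_2\le f_{\max}$, $-\alpha|p_0|\le\tilde D\tilde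 f_2-p_0\le\alpha|p_0|$, $\Lambda_g\tilde D\tilde f_2=\Lambda_g p_0$, $\|\Lambda_f(\tilde f_2-f_2)\|_0+\|\Lambda_p(\tilde D\tilde f_2-p_0)\|_0\le\xi_c$; (5) $\tilde\theta_3\in\psi_s(\tilde B\tilde\theta_2)$; (6) $\Lambda_d\tilde Df_3=\Lambda_d p_0$, $\Lambda_g\tilde Df_3=\Lambda_g\tilde B\tilde\theta_3$, and for each $e$: $f_{3,e}=0$ if $a_{p,e}=1$, $f_{3,e}=\Gamma_e\tilde d_e^T\theta_3$ if $a_{p,e}=0$; (7) $\theta_{2,u_0}=\theta_{3,u_0}=\tilde\theta_{2,u_0}=\tilde\theta_{3,u_0}=0$. Algorithm AONG. Start with $k=1$, $\hat\beta^{(1)}=0$. At iteration $k$, compute $\psi_a(\hat\beta^{(k)})$. If $\psi_a(\hat\beta^{(k)})=0$, stop and return $\hat\beta^{(k)}$. Otherwise compute $\hat\beta'^{(k)}\in\{0,1\}^{|V|}$ maximizing $\|\hat\beta'\|_0$ subject to $\psi_a(\hat\beta')\ge 1$ and $\hat\beta'_u=1$ for all $u$ with $\hat\beta^{(k)}_u=1$; then let $\hat\beta^{(k+1)}$ be a minimizer of $\|\beta\|_0$ over $\beta\in\{0,1\}^{|V|}$ satisfying the No-Good constraints $\sum_{i:\hat\beta'^{(j)}_i=0}\beta_i\ge 1$ for $j=1,\dots,k$, and continue with $k+1$.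
   Formalization: That the algorithm never gets stuck is claimed only when the PPOP problem has a feasible placement (it can have none, e.g. if some thresholds are below 1; then no optimal solution exists); the attacker's maximum is taken as 0 when no attack is feasible. *)

theory Defs
  imports Complex_Main "HOL-Library.Extended_Real"
begin

text \<open>
  The buses are the elements of a finite type \<open>'v\<close>; the lines form a finite set \<open>lines\<close> of
  elements of \<open>'e\<close>, each oriented from \<open>src\<close> to \<open>tgt\<close>.  Vectors are functions; a vector indexed
  by the lines, or by a subset of the buses, is only ever evaluated on that index set.  The 0/1
  selection matrices are given by the sets of coordinates they select.
\<close>

record ('v, 'e) grid =
  lines :: "'e set"
  src :: "'e \<Rightarrow> 'v"
  tgt :: "'e \<Rightarrow> 'v"
  reactance :: "'e \<Rightarrow> real"
  gens :: "'v set"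
  loads :: "'v set"
  meas_buses :: "'v set"
  meas_lines :: "'e set"
  ref_bus :: 'v
  p0 :: "'v \<Rightarrow> real"
  fmax :: "'e \<Rightarrow> real"
  trip :: "'e \<Rightarrow> real"  \<comment> \<open>the tripping thresholds gamma\<close>
  pgmin :: "'v \<Rightarrow> real"
  pgmax :: "'v \<Rightarrow> real"
  cost :: "'v \<Rightarrow> real"
  fluct :: real  \<comment> \<open>the load fluctuation alpha\<close>
  budget_p :: ereal
  budget_c :: ereal

definition adjacent :: "('v, 'e) grid \<Rightarrow> 'v \<Rightarrow> 'v \<Rightarrow> bool" where
  "adjacent G u v \<longleftrightarrow>
     (\<exists>e\<in>lines G. src G e = u \<and> tgt G e = v \<or> src G e = v \<and> tgt G e = u)"

text \<open>Parallel lines are not excluded.\<close>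

definition valid_grid :: "('v, 'e) grid \<Rightarrow> bool" where
  "valid_grid G \<longleftrightarrow>
     finite (lines G) \<and>
     (\<forall>e\<in>lines G. src G e \<noteq> tgt G e) \<and>
     (\<forall>u v. (adjacent G)\<^sup>*\<^sup>* u v) \<and>
     (\<forall>e\<in>lines G. reactance G e > 0) \<and>
     meas_lines G \<subseteq> lines G \<and>
     fluct G \<ge> 0"

definition incidence :: "('v, 'e) grid \<Rightarrow> 'v \<Rightarrow> 'e \<Rightarrow> real" where
  "incidence G u e = (if src G e = u then 1 else if tgt G e = u then -1 else 0)"

definition suscept :: "('v, 'e) grid \<Rightarrow> 'e \<Rightarrow> real" where
  "suscept G e = 1 / reactance G e"

text \<open>The matrix-vector products \<open>D f\<close>, \<open>\<Gamma> D\<^sup>T \<theta>\<close> and \<open>B \<theta>\<close>, where \<open>B = D \<Gamma> D\<^sup>T\<close>.\<close>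

definition net_out :: "('v, 'e) grid \<Rightarrow> ('e \<Rightarrow> real) \<Rightarrow> 'v \<Rightarrow> real" where
  "net_out G f u = (\<Sum>e\<in>lines G. incidence G u e * f e)"

definition line_flow :: "('v::finite, 'e) grid \<Rightarrow> ('v \<Rightarrow> real) \<Rightarrow> 'e \<Rightarrow> real" where
  "line_flow G \<theta> e = suscept G e * (\<Sum>u\<in>UNIV. incidence G u e * \<theta> u)"

definition admittance :: "('v, 'e) grid \<Rightarrow> 'v \<Rightarrow> 'v \<Rightarrow> real" where
  "admittance G u v = (\<Sum>e\<in>lines G. incidence G u e * suscept G e * incidence G v e)"

definition injection :: "('v::finite, 'e) grid \<Rightarrow> ('v \<Rightarrow> real) \<Rightarrow> 'v \<Rightarrow> real" where
  "injection G \<theta> u = (\<Sum>v\<in>UNIV. admittance G u v * \<theta> v)"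

definition l0 :: "'i set \<Rightarrow> ('i \<Rightarrow> 'a::zero) \<Rightarrow> nat" where
  "l0 A x = card {i \<in> A. x i \<noteq> 0}"

definition sced_feasible ::
    "('v::finite, 'e) grid \<Rightarrow> ('v \<Rightarrow> real) \<Rightarrow> ('v \<Rightarrow> real) \<Rightarrow> bool" where
  "sced_feasible G p \<theta> \<longleftrightarrow>
     (\<forall>u\<in>loads G. injection G \<theta> u = p u) \<and>
     (\<forall>e\<in>lines G. - fmax G e \<le> line_flow G \<theta> e \<and> line_flow G \<theta> e \<le> fmax G e) \<and>
     (\<forall>u\<in>gens G. pgmin G u \<le> injection G \<theta> u \<and> injection G \<theta> u \<le> pgmax G u)"

definition psi_s :: "('v::finite, 'e) grid \<Rightarrow> ('v \<Rightarrow> real) \<Rightarrow> ('v \<Rightarrow> real) set" where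
  "psi_s G p =
     {\<theta>. is_arg_min (\<lambda>\<theta>. \<Sum>u\<in>gens G. cost G u * injection G \<theta> u) (sced_feasible G p) \<theta>}"

definition x_N :: "('v, 'e) grid \<Rightarrow> ('v \<Rightarrow> nat) \<Rightarrow> 'v \<Rightarrow> nat" where
  "x_N G \<beta> u = (if \<exists>v. (v = u \<or> adjacent G u v) \<and> \<beta> v = 1 then 1 else 0)"

definition x_L :: "('v, 'e) grid \<Rightarrow> ('v \<Rightarrow> nat) \<Rightarrow> 'e \<Rightarrow> nat" where
  "x_L G \<beta> e = (if \<beta> (src G e) = 1 \<or> \<beta> (tgt G e) = 1 then 1 else 0)"

text \<open>
  Subscripts 2 and 3 are the two stages of the attack; the suffix \<open>t\<close> marks the quantities that
  carry a tilde.
\<close>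

definition attack_feasible :: "('v::finite, 'e) grid \<Rightarrow> ('v \<Rightarrow> nat) \<Rightarrow> ('e \<Rightarrow> nat) \<Rightarrow>
    ('v \<Rightarrow> real) \<Rightarrow> ('v \<Rightarrow> real) \<Rightarrow> ('v \<Rightarrow> real) \<Rightarrow> ('v \<Rightarrow> real) \<Rightarrow>
    ('e \<Rightarrow> real) \<Rightarrow> ('e \<Rightarrow> real) \<Rightarrow> ('e \<Rightarrow> real) \<Rightarrow> ('e \<Rightarrow> real) \<Rightarrow> bool" where
  "attack_feasible G \<beta> a \<theta>2 \<theta>3 \<theta>2t \<theta>3t f2 f3 f2t fcon \<longleftrightarrow>
     (\<forall>e\<in>lines G. a e \<in> {0, 1}) \<and>
     \<comment> \<open>(1)\<close>
     net_out G fcon (ref_bus G) = real (card (UNIV :: 'v set)) - 1 \<and>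
     (\<forall>u. u \<noteq> ref_bus G \<longrightarrow> net_out G fcon u = -1) \<and>
     (\<forall>e\<in>lines G. \<bar>fcon e\<bar> \<le> real (card (UNIV :: 'v set)) * (1 - real (a e))) \<and>
     \<comment> \<open>(2)\<close>
     (\<forall>e\<in>lines G. x_L G \<beta> e = 1 \<longrightarrow> a e = 0) \<and>
     (\<forall>u. x_N G \<beta> u = 1 \<longrightarrow> \<theta>2t u = \<theta>2 u) \<and>
     ereal (real (l0 (lines G) a)) \<le> budget_p G \<and>
     \<comment> \<open>(3)\<close>
     (\<forall>u. net_out G f2 u = p0 G u) \<and>
     (\<forall>e\<in>lines G. f2 e = (if a e = 1 then 0 else line_flow G \<theta>2 e)) \<and>
     \<comment> \<open>(4)\<close>
     (\<forall>e\<in>lines G. f2t e = line_flow G \<theta>2t e) \<and>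
     (\<forall>e\<in>lines G. - fmax G e \<le> f2t e \<and> f2t e \<le> fmax G e) \<and>
     (\<forall>u. - (fluct G * \<bar>p0 G u\<bar>) \<le> net_out G f2t u - p0 G u \<and>
          net_out G f2t u - p0 G u \<le> fluct G * \<bar>p0 G u\<bar>) \<and>
     (\<forall>u\<in>gens G. net_out G f2t u = p0 G u) \<and>
     ereal (real (l0 (meas_lines G) (\<lambda>e. f2t e - f2 e) +
                  l0 (meas_buses G) (\<lambda>u. net_out G f2t u - p0 G u))) \<le> budget_c G \<and>
     \<comment> \<open>(5)\<close>
     \<theta>3t \<in> psi_s G (injection G \<theta>2t) \<and>
     \<comment> \<open>(6)\<close>
     (\<forall>u\<in>loads G. net_out G f3 u = p0 G u) \<and>
     (\<forall>u\<in>gens G. net_out G f3 u = injection G \<theta>3t u) \<and>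
     (\<forall>e\<in>lines G. f3 e = (if a e = 1 then 0 else line_flow G \<theta>3 e)) \<and>
     \<comment> \<open>(7)\<close>
     \<theta>2 (ref_bus G) = 0 \<and> \<theta>3 (ref_bus G) = 0 \<and>
     \<theta>2t (ref_bus G) = 0 \<and> \<theta>3t (ref_bus G) = 0"

definition overloads :: "('v, 'e) grid \<Rightarrow> ('e \<Rightarrow> real) \<Rightarrow> nat" where
  "overloads G f = card {e \<in> lines G. \<bar>f e\<bar> > trip G e * fmax G e}"

definition attack_values :: "('v::finite, 'e) grid \<Rightarrow> ('v \<Rightarrow> nat) \<Rightarrow> nat set" where
  "attack_values G \<beta> = {overloads G f3 | a \<theta>2 \<theta>3 \<theta>2t \<theta>3t f2 f3 f2t fcon.
     attack_feasible G \<beta> a \<theta>2 \<theta>3 \<theta>2t \<theta>3t f2 f3 f2t fcon}"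

text \<open>If no attack is feasible, no line can be made to trip, so the value is 0.\<close>

definition psi_a :: "('v::finite, 'e) grid \<Rightarrow> ('v \<Rightarrow> nat) \<Rightarrow> nat" where
  "psi_a G \<beta> = (if attack_values G \<beta> = {} then 0 else Max (attack_values G \<beta>))"

definition binary :: "('v \<Rightarrow> nat) \<Rightarrow> bool" where
  "binary \<beta> \<longleftrightarrow> (\<forall>u. \<beta> u \<in> {0, 1})"

definition ppop_feasible :: "('v::finite, 'e) grid \<Rightarrow> ('v \<Rightarrow> nat) \<Rightarrow> bool" where
  "ppop_feasible G \<beta> \<longleftrightarrow> binary \<beta> \<and> psi_a G \<beta> = 0"

definition ppop_optimal :: "('v::finite, 'e) grid \<Rightarrow> ('v \<Rightarrow> nat) \<Rightarrow> bool" where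
  "ppop_optimal G \<beta> \<longleftrightarrow> is_arg_min (l0 UNIV) (ppop_feasible G) \<beta>"

definition no_good :: "('v::finite \<Rightarrow> nat) list \<Rightarrow> ('v \<Rightarrow> nat) \<Rightarrow> bool" where
  "no_good bs \<beta> \<longleftrightarrow> (\<forall>b\<in>set bs. (\<Sum>i | b i = 0. \<beta> i) \<ge> 1)"

text \<open>
  A state of Algorithm AONG at the beginning of iteration \<open>k\<close> is the current placement together
  with the maximizers found in iterations \<open>1, \<dots>, k - 1\<close>.  A step is one iteration that does not
  stop; the maximizer and the minimizer may be chosen arbitrarily, so the algorithm is a relation.
\<close>

type_synonym 'v aong_state = "('v \<Rightarrow> nat) \<times> ('v \<Rightarrow> nat) list"

definition aong_init :: "'v aong_state" where
  "aong_init = (\<lambda>_. 0, [])"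

definition aong_returns :: "('v::finite, 'e) grid \<Rightarrow> 'v aong_state \<Rightarrow> ('v \<Rightarrow> nat) \<Rightarrow> bool" where
  "aong_returns G s \<beta> \<longleftrightarrow> psi_a G (fst s) = 0 \<and> \<beta> = fst s"

inductive aong_step :: "('v::finite, 'e) grid \<Rightarrow> 'v aong_state \<Rightarrow> 'v aong_state \<Rightarrow> bool"
  for G where
  "\<lbrakk>psi_a G \<beta> \<noteq> 0;
    is_arg_max (l0 UNIV)
      (\<lambda>b. binary b \<and> psi_a G b \<ge> 1 \<and> (\<forall>u. \<beta> u = 1 \<longrightarrow> b u = 1)) b;
    is_arg_min (l0 UNIV) (\<lambda>c. binary c \<and> no_good (bs @ [b]) c) c\<rbrakk>
   \<Longrightarrow> aong_step G (\<beta>, bs) (c, bs @ [b])"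

text \<open>
  The PPOP problem can be infeasible for arbitrary data.  It is feasible in the usual situation
  where every bus is a generator or a load bus and the tripping thresholds are at least 1.
\<close>

lemma injection_altdef: "injection G \<theta> u = net_out G (line_flow G \<theta>) u"
proof -
  have "injection G \<theta> u =
      (\<Sum>v\<in>UNIV. \<Sum>e\<in>lines G. incidence G u e * suscept G e * incidence G v e * \<theta> v)"
    by (simp add: injection_def admittance_def sum_distrib_right)
  also have "\<dots> =
      (\<Sum>e\<in>lines G. \<Sum>v\<in>UNIV. incidence G u e * suscept G e * incidence G v e * \<theta> v)"
    by (rule sum.swap)
  also have "\<dots> = net_out G (line_flow G \<theta>) u"
    by (simp add: net_out_def line_flow_def sum_distrib_left mult.assoc)
  finally show ?thesis .
qed

lemma line_flow_determined:
  assumes "valid_grid G" and eq: "\<And>u. injection G x u = injection G y u" and e: "e \<in> lines G"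
  shows "line_flow G x e = line_flow G y e"
proof -
  define z where "z = (\<lambda>u. x u - y u)"
  define d where "d = (\<lambda>e. \<Sum>u\<in>UNIV. incidence G u e * z u)"
  have fin: "finite (lines G)" and pos: "\<And>e. e \<in> lines G \<Longrightarrow> suscept G e > 0"
    using assms(1) by (auto simp: valid_grid_def suscept_def)
  have flow: "line_flow G x e - line_flow G y e = suscept G e * d e" for e
    by (simp add: line_flow_def d_def z_def right_diff_distrib sum_subtractf)
  have "injection G z u = 0" for u
    using eq[of u] by (simp add: injection_def z_def right_diff_distrib sum_subtractf)
  hence "0 = (\<Sum>u\<in>UNIV. z u * injection G z u)"
    by simp
  also have "\<dots> = (\<Sum>u\<in>UNIV. \<Sum>e\<in>lines G. z u * (incidence G u e * (suscept G e * d e)))"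
    by (simp add: injection_altdef net_out_def line_flow_def d_def sum_distrib_left)
  also have "\<dots> = (\<Sum>e\<in>lines G. \<Sum>u\<in>UNIV. z u * (incidence G u e * (suscept G e * d e)))"
    by (rule sum.swap)
  also have "\<dots> = (\<Sum>e\<in>lines G. suscept G e * (d e)\<^sup>2)"
  proof (rule sum.cong)
    fix e
    have "(\<Sum>u\<in>UNIV. z u * (incidence G u e * (suscept G e * d e))) = d e * (suscept G e * d e)"
      by (subst (2) d_def, subst sum_distrib_right, rule sum.cong) (simp_all only: mult_ac)
    thus "(\<Sum>u\<in>UNIV. z u * (incidence G u e * (suscept G e * d e))) = suscept G e * (d e)\<^sup>2"
      by (simp add: power2_eq_square mult_ac)
  qed simp
  finally have sum0: "(\<Sum>e\<in>lines G. suscept G e * (d e)\<^sup>2) = 0"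
    by (rule sym)
  have "0 \<le> suscept G i * (d i)\<^sup>2" if "i \<in> lines G" for i
    using pos[OF that] by simp
  with sum0 have "\<forall>e\<in>lines G. suscept G e * (d e)\<^sup>2 = 0"
    using sum_nonneg_eq_0_iff[OF fin, of "\<lambda>i. suscept G i * (d i)\<^sup>2"] by blast
  hence "d e = 0"
    using pos[OF e] e by fastforce
  thus ?thesis
    using flow[of e] by simp
qed

lemma ppop_feasible_all_secured:
  assumes valid: "valid_grid G" and cover: "gens G \<union> loads G = UNIV"
    and trip: "\<And>e. e \<in> lines G \<Longrightarrow> trip G e \<ge> 1"
  shows "ppop_feasible G (\<lambda>_. 1)"
proof -
  have "overloads G f3 = 0"
    if att: "attack_feasible G (\<lambda>_. 1) a \<theta>2 \<theta>3 \<theta>2t \<theta>3t f2 f3 f2t fcon"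
    for a \<theta>2 \<theta>3 \<theta>2t \<theta>3t f2 f3 f2t fcon
  proof -
    have a: "\<forall>e\<in>lines G. a e = 0"
      using att by (auto simp: attack_feasible_def x_L_def)
    have "x_N G (\<lambda>_. 1) u = 1" for u
      by (auto simp: x_N_def)
    hence \<theta>: "\<theta>2t = \<theta>2"
      using att by (auto simp: attack_feasible_def)
    have f2: "\<forall>e\<in>lines G. f2 e = line_flow G \<theta>2 e" and f3: "\<forall>e\<in>lines G. f3 e = line_flow G \<theta>3 e"
      using att a by (auto simp: attack_feasible_def)
    have "net_out G f2 u = injection G \<theta>2 u" "net_out G f3 u = injection G \<theta>3 u" for u
      using f2 f3 by (simp_all add: injection_altdef net_out_def)
    hence inj2: "injection G \<theta>2 u = p0 G u"
      and inj3: "u \<in> loads G \<Longrightarrow> injection G \<theta>3 u = p0 G u"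
        "u \<in> gens G \<Longrightarrow> injection G \<theta>3 u = injection G \<theta>3t u" for u
      using att by (auto simp: attack_feasible_def)
    have sced: "sced_feasible G (injection G \<theta>2) \<theta>3t"
      using att \<theta> by (auto simp: attack_feasible_def psi_s_def is_arg_min_def)
    have "injection G \<theta>3 u = injection G \<theta>3t u" for u
      using cover sced inj2 inj3 by (cases "u \<in> gens G") (auto simp: sced_feasible_def)
    hence "line_flow G \<theta>3 e = line_flow G \<theta>3t e" if "e \<in> lines G" for e
      using line_flow_determined[OF valid] that by blast
    hence "\<bar>f3 e\<bar> \<le> fmax G e" if "e \<in> lines G" for e
      using sced f3 that by (fastforce simp: sced_feasible_def abs_le_iff)
    moreover have "fmax G e \<le> trip G e * fmax G e" if "e \<in> lines G" "\<bar>f3 e\<bar> \<le> fmax G e" for e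
    proof -
      have "0 \<le> fmax G e" using that(2) by linarith
      thus ?thesis using mult_right_mono[OF trip[OF that(1)], of "fmax G e"] by simp
    qed
    ultimately have none: "{e \<in> lines G. \<bar>f3 e\<bar> > trip G e * fmax G e} = {}"
      by (fastforce simp: not_less)
    show ?thesis
      unfolding overloads_def none by simp
  qed
  hence "attack_values G (\<lambda>_. 1) \<subseteq> {0}"
    by (auto simp: attack_values_def)
  hence "attack_values G (\<lambda>_. 1) = {} \<or> attack_values G (\<lambda>_. 1) = {0}"
    by (rule subset_singletonD)
  hence "psi_a G (\<lambda>_. 1) = 0"
    by (elim disjE) (simp_all add: psi_a_def)
  thus ?thesis
    by (simp add: ppop_feasible_def binary_def)
qed

end

theory Submission
  imports Defs "HOL-Library.FuncSet"
begin

text \<open>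
  Securing more buses only adds constraints for the attacker, so \<open>psi_a\<close> is antitone.
  Hence a placement \<open>b\<close> with \<open>psi_a G b \<ge> 1\<close> excludes, by its No-Good constraint, exactly the placements
  below \<open>b\<close>, none of which is feasible: the No-Good problem is a relaxation of PPOP, and a minimizer of the relaxation
  that is feasible is optimal.  Each maximizer lies above a placement that satisfies all earlier
  No-Good constraints, so it differs from all earlier maximizers; as there are only finitely many
  binary placements, the iteration stops.
\<close>

lemma x_L_eq_1_iff: "x_L G \<beta> e = 1 \<longleftrightarrow> \<beta> (src G e) = 1 \<or> \<beta> (tgt G e) = 1"
  by (simp add: x_L_def)

lemma x_N_eq_1_iff: "x_N G \<beta> u = 1 \<longleftrightarrow> (\<exists>v. (v = u \<or> adjacent G u v) \<and> \<beta> v = 1)"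
  by (simp add: x_N_def)

text \<open>\<open>\<beta>\<close> enters only through the premises
  \<open>x_L G \<beta> e = 1\<close> and \<open>x_N G \<beta> u = 1\<close> of the implications in
  (2). Fewer secured buses trigger fewer of them; all other constraints carry over verbatim.\<close>

lemma attack_feasible_anti_mono:
  assumes le: "\<And>u. \<beta> u = 1 \<Longrightarrow> \<beta>' u = 1"
    and feas: "attack_feasible G \<beta>' a \<theta>2 \<theta>3 \<theta>2t \<theta>3t f2 f3 f2t fcon"
  shows "attack_feasible G \<beta> a \<theta>2 \<theta>3 \<theta>2t \<theta>3t f2 f3 f2t fcon"
proof -
  have x_L: "x_L G \<beta>' e = 1" if "x_L G \<beta> e = 1" for e
    using that unfolding x_L_eq_1_iff by (blast dest: le)
  have x_N: "x_N G \<beta>' u = 1" if "x_N G \<beta> u = 1" for u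
    using that unfolding x_N_eq_1_iff by (blast dest: le)
  show ?thesis
    using feas unfolding attack_feasible_def
    apply (elim conjE)
    apply (intro conjI)
                        apply assumption+
                    apply (blast intro: x_L)
                   apply (blast intro: x_N)
                  apply assumption+
    done
qed

text \<open>Each value counts lines, so it is at most \<open>card (lines G)\<close>. Finiteness is
  what makes \<open>Max\<close> in \<open>psi_a\<close> a genuine maximum.\<close>

lemma finite_attack_values:
  assumes "finite (lines G)"
  shows "finite (attack_values G \<beta>)"
proof (rule finite_subset)
  show "attack_values G \<beta> \<subseteq> {..card (lines G)}"
    using assms by (auto simp: attack_values_def overloads_def intro: card_mono)
qed simp

lemma psi_a_anti_mono:
  assumes fin: "finite (lines G)" and le: "\<And>u. \<beta> u = 1 \<Longrightarrow> \<beta>' u = 1"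
  shows "psi_a G \<beta>' \<le> psi_a G \<beta>"
proof -
  have "attack_values G \<beta>' \<subseteq> attack_values G \<beta>"
    unfolding attack_values_def
    by (intro Collect_mono impI, elim exE conjE, intro exI conjI, assumption,
        rule attack_feasible_anti_mono[OF le])
  \<comment> \<open>If no attack is feasible against \<open>\<beta>'\<close>, the left side is the
    default 0; otherwise both sets are nonempty and \<open>Max\<close> is monotone.\<close>
  thus ?thesis
    using finite_attack_values[OF fin] by (auto simp: psi_a_def intro: Max_mono)
qed

lemma binary_nonzero: "binary b \<Longrightarrow> b u \<noteq> 0 \<Longrightarrow> b u = 1"
  unfolding binary_def by (metis empty_iff insert_iff)

lemma finite_binary: "finite {b :: 'v::finite \<Rightarrow> nat. binary b}"
proof -
  have "finite (PiE (UNIV :: 'v set) (\<lambda>_. {0, 1 :: nat}))"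
    by (rule finite_PiE) auto
  thus ?thesis
    by (rule finite_subset[rotated]) (auto dest: binary_nonzero)
qed

lemma binary_no_goodD:
  assumes "binary c" "no_good bs c" "b \<in> set bs"
  obtains i where "b i = 0" "c i = 1"
proof -
  have "(\<Sum>i | b i = 0. c i) \<noteq> 0"
    using assms(2,3) by (fastforce simp: no_good_def)
  then obtain i where "b i = 0" "c i \<noteq> 0"
    using sum.not_neutral_contains_not_neutral[of c "{i. b i = 0}"] by blast
  thus thesis
    using that binary_nonzero[OF assms(1)] by blast
qed

text \<open>A violated constraint for \<open>b\<close> forces \<open>c\<close> to vanish wherever
  \<open>b\<close> does, so \<open>c\<close> lies below \<open>b\<close> and
  \<open>psi_a G b \<le> psi_a G c = 0\<close>, a contradiction.\<close>

lemma no_good_if_ppop_feasible: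
  assumes fin: "finite (lines G)" and c: "ppop_feasible G c"
    and bs: "\<And>b. b \<in> set bs \<Longrightarrow> binary b \<and> psi_a G b \<ge> 1"
  shows "no_good bs c"
  unfolding no_good_def
proof (rule ballI, rule ccontr)
  fix b assume b: "b \<in> set bs" and "\<not> (\<Sum>i | b i = 0. c i) \<ge> 1"
  hence zero: "\<And>i. b i = 0 \<Longrightarrow> c i = 0"
    by (simp add: not_le)
  have "b u = 1" if "c u = 1" for u
    using zero[of u] that bs[OF b] binary_nonzero[of b u] by fastforce
  hence "psi_a G b \<le> psi_a G c"
    by (rule psi_a_anti_mono[OF fin])
  thus False
    using bs[OF b] c by (simp add: ppop_feasible_def)
qed

text \<open>The minimality conjunct gives optimality on return, distinctness gives termination, and
  the last conjunct ensures that no recorded constraint cuts off a PPOP-feasible placement.\<close>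

definition aong_inv :: "('v::finite, 'e) grid \<Rightarrow> 'v aong_state \<Rightarrow> bool" where
  "aong_inv G s \<longleftrightarrow>
     is_arg_min (l0 UNIV) (\<lambda>c. binary c \<and> no_good (snd s) c) (fst s) \<and>
     distinct (snd s) \<and> (\<forall>b\<in>set (snd s). binary b \<and> psi_a G b \<ge> 1)"

lemma aong_inv_init: "aong_inv G aong_init"
  by (simp add: aong_inv_def aong_init_def is_arg_min_def binary_def no_good_def l0_def)

lemma aong_inv_step:
  assumes "aong_step G s s'" and "aong_inv G s"
  shows "aong_inv G s'"
  using assms
proof (induction rule: aong_step.induct)
  case (1 \<beta> b bs c)
  have \<beta>: "binary \<beta>" "no_good bs \<beta>"
    using 1 by (auto simp: aong_inv_def is_arg_min_def)
  have b: "binary b \<and> psi_a G b \<ge> 1" "\<And>u. \<beta> u = 1 \<Longrightarrow> b u = 1"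
    using 1 by (auto simp: is_arg_max_def)
  \<comment> \<open>\<open>b\<close> secures every bus that \<open>\<beta>\<close> secures, whereas
    each earlier maximizer misses one of them.\<close>
  have "b \<notin> set bs"
  proof
    assume "b \<in> set bs"
    with \<beta> obtain i where "b i = 0" "\<beta> i = 1"
      by (rule binary_no_goodD)
    thus False
      using b(2)[of i] by simp
  qed
  thus ?case
    using 1 b(1) by (auto simp: aong_inv_def)
qed

lemma aong_inv_reachable:
  assumes "(aong_step G)\<^sup>*\<^sup>* aong_init s"
  shows "aong_inv G s"
  using assms by induction (auto intro: aong_inv_init aong_inv_step)

lemma aong_terminates:
  fixes G :: "('v::finite, 'e) grid"
  shows "\<nexists>S. S 0 = aong_init \<and> (\<forall>k::nat. aong_step G (S k) (S (Suc k)))"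
proof
  assume "\<exists>S. S 0 = aong_init \<and> (\<forall>k::nat. aong_step G (S k) (S (Suc k)))"
  then obtain S where S0: "S 0 = aong_init" and step: "\<And>k::nat. aong_step G (S k) (S (Suc k))"
    by blast
  have inv: "aong_inv G (S k)" for k
    by (induction k) (auto simp: S0 aong_inv_init intro: aong_inv_step[OF step])
  have len: "length (snd (S k)) = k" for k
  proof (induction k)
    case (Suc k)
    thus ?case
      using step[of k] by (auto elim!: aong_step.cases)
  qed (simp add: S0 aong_init_def)
  define N where "N = card {b :: 'v \<Rightarrow> nat. binary b}"
  \<comment> \<open>Pigeonhole: each step appends one placement, so after \<open>Suc N\<close> steps
    the list holds \<open>Suc N\<close> distinct binary placements, while only \<open>N\<close>
    exist.\<close>
  have "Suc N = card (set (snd (S (Suc N))))"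
    using inv[of "Suc N"] len[of "Suc N"] by (simp add: aong_inv_def distinct_card)
  also have "\<dots> \<le> N"
    unfolding N_def using inv by (intro card_mono finite_binary) (auto simp: aong_inv_def)
  finally show False
    by simp
qed

lemma aong_returns_ppop_optimal:
  assumes fin: "finite (lines G)" and inv: "aong_inv G s" and ret: "aong_returns G s \<beta>"
  shows "ppop_optimal G \<beta>"
proof -
  have min: "is_arg_min (l0 UNIV) (\<lambda>c. binary c \<and> no_good (snd s) c) \<beta>" and "psi_a G \<beta> = 0"
    using inv ret by (auto simp: aong_inv_def aong_returns_def)
  hence feas: "ppop_feasible G \<beta>"
    by (auto simp: ppop_feasible_def is_arg_min_def)
  have "\<not> l0 UNIV c < l0 UNIV \<beta>" if c: "ppop_feasible G c" for c
  proof -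
    have "no_good (snd s) c"
      using inv by (intro no_good_if_ppop_feasible[OF fin c]) (auto simp: aong_inv_def)
    thus ?thesis
      using min c by (auto simp: is_arg_min_def ppop_feasible_def)
  qed
  with feas show ?thesis
    by (auto simp: ppop_optimal_def is_arg_min_def)
qed

text \<open>Both subproblems are solvable: \<open>\<beta>\<close> itself is admissible for the
  maximization and \<open>c\<^sub>0\<close> for the minimization, and \<open>l0\<close> takes
  natural values bounded by the number of buses.\<close>

lemma aong_progress:
  fixes G :: "('v::finite, 'e) grid"
  assumes fin: "finite (lines G)" and inv: "aong_inv G s"
    and feas: "ppop_feasible G c\<^sub>0" and nz: "psi_a G (fst s) \<noteq> 0"
  shows "\<exists>s'. aong_step G s s'"
proof -
  obtain \<beta> bs where s: "s = (\<beta>, bs)"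
    by fastforce
  let ?P = "\<lambda>b. binary b \<and> psi_a G b \<ge> 1 \<and> (\<forall>u. \<beta> u = 1 \<longrightarrow> b u = 1)"
  have "?P \<beta>"
    using inv nz by (auto simp: s aong_inv_def is_arg_min_def)
  moreover have "\<forall>b. ?P b \<longrightarrow> l0 UNIV b < Suc (card (UNIV :: 'v set))"
    by (simp add: l0_def less_Suc_eq_le card_mono)
  ultimately obtain b where b: "?P b" "\<forall>b'. ?P b' \<longrightarrow> l0 UNIV b' \<le> l0 UNIV b"
    using ex_has_greatest_nat[of ?P \<beta> "l0 UNIV"] by blast
  hence max: "is_arg_max (l0 UNIV) ?P b"
    by (auto simp: is_arg_max_def not_less)
  let ?Q = "\<lambda>c. binary c \<and> no_good (bs @ [b]) c"
  have "no_good (bs @ [b]) c\<^sub>0"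
    using inv b(1) by (intro no_good_if_ppop_feasible[OF fin feas]) (auto simp: s aong_inv_def)
  hence "?Q c\<^sub>0"
    using feas by (simp add: ppop_feasible_def)
  then obtain c where "?Q c" "\<forall>c'. ?Q c' \<longrightarrow> l0 UNIV c \<le> l0 UNIV c'"
    using ex_has_least_nat[of ?Q c\<^sub>0 "l0 UNIV"] by blast
  hence "is_arg_min (l0 UNIV) ?Q c"
    by (auto simp: is_arg_min_def not_less)
  hence "aong_step G (\<beta>, bs) (c, bs @ [b])"
    using max nz by (intro aong_step.intros) (simp_all add: s)
  thus ?thesis
    unfolding s by blast
qed

text \<open>The algorithm is a relation, so correctness has three parts: no infinite run, optimality
  of whatever is returned, and, if PPOP is feasible, no stuck reachable state. Then every maximal
  run ends by returning an optimum.\<close>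

theorem mainTheorem3:
  fixes G :: "('v::finite, 'e) grid"
  assumes "valid_grid G"
  shows "(\<nexists>S. S 0 = aong_init \<and> (\<forall>k::nat. aong_step G (S k) (S (Suc k)))) \<and>
    (\<forall>s \<beta>. (aong_step G)\<^sup>*\<^sup>* aong_init s \<and> aong_returns G s \<beta> \<longrightarrow> ppop_optimal G \<beta>) \<and>
    ((\<exists>\<beta>. ppop_feasible G \<beta>) \<longrightarrow>
      (\<forall>s. (aong_step G)\<^sup>*\<^sup>* aong_init s \<longrightarrow> (\<exists>\<beta>. aong_returns G s \<beta>) \<or> (\<exists>s'. aong_step G s s')))"
proof -
  have fin: "finite (lines G)"
    using assms by (simp add: valid_grid_def)
  have "(\<exists>\<beta>. aong_returns G s \<beta>) \<or> (\<exists>s'. aong_step G s s')"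
    if "ppop_feasible G \<beta>" "(aong_step G)\<^sup>*\<^sup>* aong_init s" for \<beta> s
    using aong_progress[OF fin aong_inv_reachable[OF that(2)] that(1)]
    by (auto simp: aong_returns_def)
  thus ?thesis
    using aong_terminates aong_returns_ppop_optimal[OF fin aong_inv_reachable] by blast
qed

end
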